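(* Let $\sigma\in(-1,+\infty)$, let $\rho\in\mathbb{R}$, and let $\lambda\in\mathbb{R}$ with $\lambda\neq 0$. Then $$c^\bullet_{\lambda,\rho,+}=\frac{|\Gamma(\sigma+1+\mathbf{i}\rho)|}{\pi\,\lambda^{\sigma+1}}\,\exp\left(\frac{\pi\rho}{2}\right)F_\sigma(\rho,\lambda).$$
   Context: $\mathbf{i}$ is the imaginary unit. All complex powers are principal ($\arg\in(-\pi,\pi]$). Cone, functions and functional. Let $\Lambda=\{x\in\mathbb{R}^3: x_1^2-x_2^2-x_3^2=0\}$. For a real number $x$ and complex $\mu$, $x_+^\mu$ equals $|x|^\mu$ if $x>0$ and $0$ otherwise; $x_-^\mu$ equals $|x|^\mu$ if $x<0$ and $0$ otherwise. For $\rho\in\mathbb{R}$ put $f_{\rho,\pm}(x)=(x_2)_\pm^{\sigma-\mathbf{i}\rho}(x_1+x_3)^{\mathbf{i}\rho}$ (homogeneous of degree $\sigma$), and for $\lambda\in\mathbb{R}$ put $f^\bullet_\lambda(x)=(x_1+x_2)^{-\sigma-1}\exp\frac{\mathbf{i}\lambda x_3}{x_1+x_2}$ (homogeneous of degree $-\sigma-1$; the superscript $\bullet$ means that $\sigma$ is replaced by $-\sigma-1$). Let $\gamma_1\subset\Lambda$ be the parabola $x_1+x_2=1$, parametrized by $x_1=\frac12(1+\alpha^2)$, $x_2=\frac12(1-\alpha^2)$, $x_3=\alpha$, $\alpha\in\mathbb{R}$, and let $\mathsf{F}_1(f,g)=\int_{\mathbb{R}} f(x(\alpha))\,g(x(\alpha))\,\mathrm{d}\alpha$.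 Matrix elements. The numbers $c^\bullet_{\lambda,\rho,\pm}$ are the coefficients of the expansion $f^\bullet_\lambda=\int_{\mathbb{R}}[c^\bullet_{\lambda,\rho,+}f^\bullet_{\rho,+}+c^\bullet_{\lambda,\rho,-}f^\bullet_{\rho,-}]\,\mathrm{d}\rho$, where $f^\bullet_{\rho,\pm}(x)=(x_2)_\pm^{-\sigma-1-\mathbf{i}\rho}(x_1+x_3)^{\mathbf{i}\rho}$. They are given by $c^\bullet_{\lambda,\rho,\pm}=\frac{1}{2\pi}\mathsf{F}_1(f^\bullet_\lambda,f_{-\rho,\pm})$, that is, $$c^\bullet_{\lambda,\rho,\pm}=\frac{1}{2\pi}\int_{\mathbb{R}}\left(\frac{1-\alpha^2}{2}\right)_\pm^{\sigma+\mathbf{i}\rho}\left(\frac{1+\alpha^2}{2}+\alpha\right)^{-\mathbf{i}\rho}\exp(\mathbf{i}\lambda\alpha)\,\mathrm{d}\alpha .$$ Coulomb function. For real $\sigma>-1$ and real $\rho$, let $C_\sigma(\rho)=2^\sigma e^{-\pi\rho/2}\,|\Gamma(\sigma+1+\mathbf{i}\rho)|/\Gamma(2\sigma+2)$. The regular Coulomb function is $F_\sigma(\rho,\lambda)=2^{-\sigma-1}C_\sigma(\rho)(\mp\mathbf{i})^{\sigma+1}M_{\pm\mathbf{i}\rho,\sigma+\frac12}(\pm2\mathbf{i}\lambda)$, where $M_{\mu,\nu}(z)=z^{\nu+\frac12}e^{-z/2}{}_1F_1(\nu-\mu+\frac12;2\nu+1;z)$ is the Whittaker function of the first kind. Equivalently,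 $F_\sigma(\rho,\lambda)=C_\sigma(\rho)\,\lambda^{\sigma+1}e^{-\mathbf{i}\lambda}\,{}_1F_1(\sigma+1-\mathbf{i}\rho;2\sigma+2;2\mathbf{i}\lambda)$, and this form is used for every real $\lambda\ne0$. *)

theory Defs
  imports "HOL-Analysis.Analysis"
begin

text \<open>Complex \<open>powr\<close> uses the principal logarithm and satisfies \<open>0 powr \<mu> = 0\<close>.\<close>

definition pos_powr :: "real \<Rightarrow> complex \<Rightarrow> complex" where
  "pos_powr x \<mu> = (if x > 0 then complex_of_real \<bar>x\<bar> powr \<mu> else 0)"

definition cone :: "(real^3) set" where
  "cone = {x. (x$1)\<^sup>2 - (x$2)\<^sup>2 - (x$3)\<^sup>2 = 0}"

text \<open>The functions on the cone are given by formulas on all of \<open>real^3\<close>; only their values on the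
  section \<open>gamma1\<close> of the cone enter \<open>F1\<close>. The first argument \<open>s\<close> is the degree of homogeneity,
  so the functions with superscript bullet arise for \<open>s = - \<sigma> - 1\<close>.\<close>

definition f_hyp_plus :: "real \<Rightarrow> real \<Rightarrow> real^3 \<Rightarrow> complex" where
  "f_hyp_plus s \<rho> x =
     pos_powr (x$2) (complex_of_real s - \<i> * complex_of_real \<rho>)
     * complex_of_real (x$1 + x$3) powr (\<i> * complex_of_real \<rho>)"

definition f_par :: "real \<Rightarrow> real \<Rightarrow> real^3 \<Rightarrow> complex" where
  "f_par s lam x =
     complex_of_real (x$1 + x$2) powr complex_of_real s
     * exp (\<i> * complex_of_real lam * complex_of_real (x$3) / complex_of_real (x$1 + x$2))"

definition gamma1 :: "real \<Rightarrow> real^3" where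
  "gamma1 \<alpha> = vector [(1 + \<alpha>\<^sup>2) / 2, (1 - \<alpha>\<^sup>2) / 2, \<alpha>]"

lemma gamma1_in_cone: "gamma1 \<alpha> \<in> cone"
  by (simp add: gamma1_def cone_def power2_eq_square field_simps)

lemma gamma1_section: "gamma1 \<alpha> $ 1 + gamma1 \<alpha> $ 2 = 1"
  by (simp add: gamma1_def field_simps)

definition F1 :: "(real^3 \<Rightarrow> complex) \<Rightarrow> (real^3 \<Rightarrow> complex) \<Rightarrow> complex" where
  "F1 f g = (LINT \<alpha>|lborel. f (gamma1 \<alpha>) * g (gamma1 \<alpha>))"

definition c_bullet_plus :: "real \<Rightarrow> real \<Rightarrow> real \<Rightarrow> complex" where
  "c_bullet_plus \<sigma> lam \<rho> = 1 / (2 * of_real pi) * F1 (f_par (- \<sigma> - 1) lam) (f_hyp_plus \<sigma> (- \<rho>))"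

text \<open>The integrand vanishes off \<open>]-1, 1[\<close>, where its modulus is \<open>((1 - \<alpha>\<^sup>2) / 2) powr \<sigma>\<close>;
  hence the integral converges absolutely for \<open>\<sigma> > -1\<close>.\<close>

lemma c_bullet_plus_integral:
  "c_bullet_plus \<sigma> lam \<rho> = 1 / (2 * of_real pi) *
     (LINT \<alpha>|lborel. pos_powr ((1 - \<alpha>\<^sup>2) / 2) (of_real \<sigma> + \<i> * of_real \<rho>)
        * complex_of_real ((1 + \<alpha>\<^sup>2) / 2 + \<alpha>) powr (- \<i> * of_real \<rho>)
        * exp (\<i> * of_real lam * of_real \<alpha>))"
proof -
  have "f_par (- \<sigma> - 1) lam (gamma1 \<alpha>) = exp (\<i> * of_real lam * of_real \<alpha>)" for \<alpha>
    unfolding f_par_def gamma1_section by (simp add: gamma1_def)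
  moreover have "f_hyp_plus \<sigma> (- \<rho>) (gamma1 \<alpha>) =
      pos_powr ((1 - \<alpha>\<^sup>2) / 2) (of_real \<sigma> + \<i> * of_real \<rho>)
      * complex_of_real ((1 + \<alpha>\<^sup>2) / 2 + \<alpha>) powr (- \<i> * of_real \<rho>)" for \<alpha>
    by (simp add: f_hyp_plus_def gamma1_def)
  ultimately show ?thesis
    by (simp add: c_bullet_plus_def F1_def mult_ac)
qed

definition hypergeo_1F1 :: "complex \<Rightarrow> complex \<Rightarrow> complex \<Rightarrow> complex" where
  "hypergeo_1F1 a b z = eval_fps (fps_hypergeo [a] [b] 1) z"

lemma hypergeo_1F1_series:
  "hypergeo_1F1 a b z = (\<Sum>n. pochhammer a n / pochhammer b n * z ^ n / fact n)"
  by (simp add: hypergeo_1F1_def eval_fps_def)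

definition coulomb_C :: "real \<Rightarrow> real \<Rightarrow> real" where
  "coulomb_C \<sigma> \<rho> =
     2 powr \<sigma> * exp (- pi * \<rho> / 2) * cmod (Gamma (of_real (\<sigma> + 1) + \<i> * of_real \<rho>))
     / Gamma (2 * \<sigma> + 2)"

text \<open>Complex-valued, since \<open>lam powr (\<sigma> + 1)\<close> is a principal power also for negative \<open>lam\<close>.\<close>

definition coulomb_F :: "real \<Rightarrow> real \<Rightarrow> real \<Rightarrow> complex" where
  "coulomb_F \<sigma> \<rho> lam =
     of_real (coulomb_C \<sigma> \<rho>) * complex_of_real lam powr of_real (\<sigma> + 1)
     * exp (- \<i> * of_real lam)
     * hypergeo_1F1 (of_real (\<sigma> + 1) - \<i> * of_real \<rho>) (of_real (2 * \<sigma> + 2)) (2 * \<i> * of_real lam)"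

end

theory Submission
  imports Defs
begin

text \<open>
  On the support \<open>]-1, 1[\<close> of the integrand, the bases of the two powers factor as
  \<open>(1 - \<alpha>\<^sup>2) / 2 = (1 - \<alpha>) (1 + \<alpha>) / 2\<close> and \<open>(1 + \<alpha>\<^sup>2) / 2 + \<alpha> = (1 + \<alpha>)\<^sup>2 / 2\<close>. The substitution
  \<open>\<alpha> = 2 t - 1\<close> therefore turns the matrix element into a constant times
  \<open>\<integral>\<^sub>0\<^sup>1 t\<^bsup>a-1\<^esup> (1 - t)\<^bsup>b-1\<^esup> e\<^bsup>z t\<^esup> dt\<close> with the conjugate parameters \<open>a = \<sigma> + 1 - \<i> \<rho>\<close> and
  \<open>b = \<sigma> + 1 + \<i> \<rho>\<close>, and \<open>z = 2 \<i> \<lambda>\<close>. By Euler's integral representation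
  (\<open>Euler_integral_1F1\<close>) this is \<open>B(a, b) \<cdot> \<^sub>1F\<^sub>1(a; a + b; z)\<close>, and
  \<open>B(a, b) = \<bar>\<Gamma>(\<sigma> + 1 + \<i> \<rho>)\<bar>\<^sup>2 / \<Gamma>(2 \<sigma> + 2)\<close> because \<open>\<Gamma>(a)\<close> and \<open>\<Gamma>(b)\<close> are
  conjugate. One of the two factors \<open>\<bar>\<Gamma>\<bar>\<close> is the one in \<open>coulomb_C\<close>, the other stands in the theorem; the
  powers of \<open>\<lambda>\<close> and the exponentials of \<open>\<pi> \<rho> / 2\<close> cancel.

  Euler's representation follows by integrating the exponential series term by term: the \<open>n\<close>-th
  moment of the kernel is \<open>B(a + n, b)\<close>, which is \<open>B(a, b)\<close> times a quotient of Pochhammer symbols. This uses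
  the Beta integral for complex exponents (\<open>integral_Beta_complex\<close>). It comes from
  convolving the two Gamma densities \<open>x\<^bsup>a-1\<^esup> e\<^bsup>-x\<^esup>\<close> and \<open>x\<^bsup>b-1\<^esup> e\<^bsup>-x\<^esup>\<close>: the convolution at
  \<open>u > 0\<close> is, by scaling, the Beta integral times \<open>u\<^bsup>a+b-1\<^esup> e\<^bsup>-u\<^esup>\<close>, while its total integral is
  \<open>\<Gamma>(a) \<Gamma>(b)\<close>.

  Writing all kernels with \<open>pos_powr\<close> builds their supports into the functions, so that every integral
  below runs over the whole line.
\<close>

lemma pos_powr_eq_exp: "pos_powr x \<mu> = (if x > 0 then exp (\<mu> * of_real (ln x)) else 0)"
  by (auto simp: pos_powr_def powr_def Ln_of_real)

lemma measurable_pos_powr [measurable]: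
  assumes [measurable]: "f \<in> borel_measurable M"
  shows "(\<lambda>x. pos_powr (f x) \<mu>) \<in> borel_measurable M"
  unfolding pos_powr_eq_exp by measurable

lemma norm_pos_powr: "cmod (pos_powr x \<mu>) = (if x > 0 then x powr Re \<mu> else 0)"
  by (simp add: pos_powr_eq_exp norm_exp_eq_Re powr_def)

lemma pos_powr_scale: "u > 0 \<Longrightarrow> pos_powr (u * x) \<mu> = pos_powr u \<mu> * pos_powr x \<mu>"
  by (simp add: pos_powr_eq_exp zero_less_mult_iff ln_mult exp_add [symmetric] algebra_simps)

lemma pos_powr_add: "pos_powr x (\<mu> + \<nu>) = pos_powr x \<mu> * pos_powr x \<nu>"
  by (simp add: pos_powr_eq_exp exp_add [symmetric] algebra_simps)

lemma pos_powr_of_nat: "x > 0 \<Longrightarrow> pos_powr x (of_nat n) = of_real x ^ n"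
  by (simp add: pos_powr_eq_exp exp_of_nat_mult exp_of_real)

lemma Re_pos_notin_nonpos_Ints: "Re z > 0 \<Longrightarrow> z \<notin> \<int>\<^sub>\<le>\<^sub>0"
  by (auto elim!: nonpos_Ints_cases)

text \<open>Euler's integral for \<open>\<Gamma>\<close>, transferred from the Henstock-Kurzweil integral and the completed
  Lebesgue measure to \<open>lborel\<close>, over whose square the integrals are interchanged below.\<close>

lemma has_bochner_integral_Gamma:
  assumes "Re z > 0"
  shows "has_bochner_integral lborel (\<lambda>t. pos_powr t (z - 1) * exp (- of_real t)) (Gamma z)"
proof -
  define g where "g = (\<lambda>t. pos_powr t (z - 1) * exp (- complex_of_real t))"
  define h where "h = (\<lambda>t. of_real t powr (z - 1) / complex_of_real (exp t))"
  have g: "g t = indicator {0<..} t *\<^sub>R h t" for t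
    by (auto simp: g_def h_def pos_powr_def indicator_def exp_minus exp_of_real field_simps)
  have meas: "g \<in> borel_measurable lborel"
    unfolding g_def by measurable
  have "set_integrable lebesgue {0<..} h"
    unfolding h_def by (rule absolutely_integrable_Gamma_integral' [OF assms])
  moreover from this have "set_lebesgue_integral lebesgue {0<..} h = Gamma z"
    using Gamma_integral_complex' [OF assms]
    by (simp add: set_lebesgue_integral_eq_integral(2) h_def integral_unique)
  ultimately have "has_bochner_integral lebesgue g (Gamma z)"
    by (simp add: has_bochner_integral_iff set_integrable_def set_lebesgue_integral_def flip: g)
  then show ?thesis
    using meas unfolding g_def [symmetric]
    by (simp add: has_bochner_integral_iff integrable_completion integral_completion)
qed

text \<open>Interchanging the integrals reduces the claim to translation invariance of the inner integral
  of \<open>g\<close>; the same invariance, applied to \<open>\<bar>g\<bar>\<close>, gives the integrability that Fubini's theorem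
  asks for.\<close>

lemma integral_convolution:
  fixes f g :: "real \<Rightarrow> complex"
  assumes f: "integrable lborel f" and g: "integrable lborel g"
  shows "(LINT u|lborel. LINT x|lborel. f x * g (u - x)) = integral\<^sup>L lborel f * integral\<^sup>L lborel g"
proof -
  have [measurable]: "f \<in> borel_measurable borel" "g \<in> borel_measurable borel"
    using f g by (auto dest: borel_measurable_integrable)
  have shift: "integrable lborel (\<lambda>u. g (u - x))"
      "(LINT u|lborel. g (u - x)) = integral\<^sup>L lborel g"
      "(LINT u|lborel. cmod (g (u - x))) = (LINT u|lborel. cmod (g u))" for x
    using lborel_integrable_real_affine [OF g, of 1 "- x"]
      lborel_integral_real_affine [of 1 g "- x"]
      lborel_integral_real_affine [of 1 "\<lambda>u. cmod (g u)" "- x"]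
    by (simp_all add: algebra_simps)
  have "integrable (lborel \<Otimes>\<^sub>M lborel) (\<lambda>(x, u). f x * g (u - x))"
  proof (rule lborel_pair.Fubini_integrable)
    show "integrable lborel (\<lambda>x. LINT u|lborel. norm (case (x, u) of (x, u) \<Rightarrow> f x * g (u - x)))"
      using f by (simp add: norm_mult shift)
    show "AE x in lborel. integrable lborel (\<lambda>u. case (x, u) of (x, u) \<Rightarrow> f x * g (u - x))"
      using shift(1) by simp
  qed measurable
  from lborel_pair.Fubini_integral [OF this] show ?thesis
    by (simp add: shift)
qed

text \<open>The modulus of the kernel is the kernel for the real exponents \<open>Re a\<close> and \<open>Re b\<close>.\<close>

lemma integrable_Beta_complex:
  assumes "Re a > 0" "Re b > 0"
  shows "integrable lborel (\<lambda>t. pos_powr t (a - 1) * pos_powr (1 - t) (b - 1))"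
proof (rule Bochner_Integration.integrable_bound)
  show "integrable lborel
      (\<lambda>t. indicator {0..1} t *\<^sub>R (t powr (Re a - 1) * (1 - t) powr (Re b - 1)))"
    using integrable_Beta [OF assms] by (simp add: set_integrable_def)
qed (auto simp: norm_mult norm_pos_powr indicator_def)

text \<open>Both sides, multiplied by \<open>\<Gamma>(a + b)\<close>, are the total integral of the convolution of two Gamma
  densities. The convolution is again a Gamma density, with parameter \<open>a + b\<close>, up to a factor that is
  the Beta integral.\<close>

lemma integral_Beta_complex:
  assumes "Re a > 0" "Re b > 0"
  shows "(LINT t|lborel. pos_powr t (a - 1) * pos_powr (1 - t) (b - 1)) = Beta a b"
    (is "?B = _")
proof -
  define G where "G z t = pos_powr t (z - 1) * exp (- complex_of_real t)" for z t
  have G: "integrable lborel (G z)" "integral\<^sup>L lborel (G z) = Gamma z" if "Re z > 0" for z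
    using has_bochner_integral_Gamma [OF that]
    by (simp_all add: G_def [abs_def] has_bochner_integral_iff)
  have inner: "(LINT x|lborel. G a x * G b (u - x)) = ?B * G (a + b) u" for u
  proof (cases "u > 0")
    case True
    \<comment> \<open>The substitution \<open>x = u t\<close> turns \<open>u - x\<close> into \<open>u (1 - t)\<close>, so the powers of \<open>u\<close>
        come out of both factors.\<close>
    have "(LINT x|lborel. G a x * G b (u - x)) = u *\<^sub>R (LINT t|lborel. G a (u * t) * G b (u - u * t))"
      using lborel_integral_real_affine [of u "\<lambda>x. G a x * G b (u - x)" 0] True by simp
    also have "(\<lambda>t. G a (u * t) * G b (u - u * t)) =
        (\<lambda>t. pos_powr u (a - 1) * pos_powr u (b - 1) * exp (- of_real u) *
             (pos_powr t (a - 1) * pos_powr (1 - t) (b - 1)))"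
    proof
      fix t
      have "u - u * t = u * (1 - t)"
        by (simp add: algebra_simps)
      moreover have "exp (- complex_of_real (u * t)) * exp (- complex_of_real (u * (1 - t))) =
          exp (- of_real u)"
        by (simp add: exp_add [symmetric] algebra_simps)
      ultimately show "G a (u * t) * G b (u - u * t) =
          pos_powr u (a - 1) * pos_powr u (b - 1) * exp (- of_real u) *
             (pos_powr t (a - 1) * pos_powr (1 - t) (b - 1))"
        using pos_powr_scale [OF True]
        by (simp only: G_def) (simp add: mult_ac)
    qed
    also have "u *\<^sub>R (LINT t|lborel. pos_powr u (a - 1) * pos_powr u (b - 1) * exp (- of_real u) *
             (pos_powr t (a - 1) * pos_powr (1 - t) (b - 1))) =
        ?B * (of_real u * pos_powr u (a - 1) * pos_powr u (b - 1) * exp (- of_real u))"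
      unfolding integral_mult_right_zero by (simp add: scaleR_conv_of_real mult_ac)
    also have "of_real u * pos_powr u (a - 1) * pos_powr u (b - 1) = pos_powr u (a + b - 1)"
      using pos_powr_of_nat [OF True, of 1] pos_powr_add [of u 1 "a - 1"]
        pos_powr_add [of u a "b - 1"] by (simp add: add_diff_eq)
    finally show ?thesis
      by (simp add: G_def)
  next
    case False
    then have "(\<lambda>x. G a x * G b (u - x)) = (\<lambda>_. 0)"
      by (auto simp: G_def pos_powr_def)
    moreover have "G (a + b) u = 0"
      using False by (simp add: G_def pos_powr_def)
    ultimately show ?thesis
      by simp
  qed
  have "?B * Gamma (a + b) = (LINT u|lborel. LINT x|lborel. G a x * G b (u - x))"
    using G(2) [of "a + b"] assms by (simp add: inner)
  also have "\<dots> = Gamma a * Gamma b"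
    using integral_convolution [OF G(1) G(1), of a b] G(2) assms by simp
  finally have "?B * Gamma (a + b) = Gamma a * Gamma b" .
  moreover have "Gamma (a + b) \<noteq> 0"
    using assms by (simp add: Gamma_eq_zero_iff Re_pos_notin_nonpos_Ints)
  ultimately show ?thesis
    by (simp add: Beta_def field_simps)
qed

lemma Beta_add_of_nat_left:
  fixes a b :: complex
  assumes "Re a > 0" "Re b > 0"
  shows "Beta (a + of_nat n) b = Beta a b * pochhammer a n / pochhammer (a + b) n"
proof -
  have "a \<notin> \<int>\<^sub>\<le>\<^sub>0" "a + b \<notin> \<int>\<^sub>\<le>\<^sub>0"
    using assms by (simp_all add: Re_pos_notin_nonpos_Ints)
  then show ?thesis
    by (simp add: pochhammer_Gamma Beta_def Gamma_eq_zero_iff add_ac)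
qed

text \<open>Termwise integration of the exponential series. On the support of the kernel \<open>\<bar>t\<bar> \<le> 1\<close>, so
  the series is dominated by the integrable modulus of the kernel times the series of \<open>exp \<bar>z\<bar>\<close>.\<close>

lemma Euler_integral_1F1:
  assumes a: "Re a > 0" and b: "Re b > 0"
  shows "(LINT t|lborel. pos_powr t (a - 1) * pos_powr (1 - t) (b - 1) * exp (z * of_real t)) =
    Beta a b * hypergeo_1F1 a (a + b) z"
proof -
  define k where "k t = pos_powr t (a - 1) * pos_powr (1 - t) (b - 1)" for t
  define T where "T n t = z ^ n / fact n * (k t * of_real t ^ n)" for n and t :: real
  have moment: "k t * of_real t ^ n =
      pos_powr t (a + of_nat n - 1) * pos_powr (1 - t) (b - 1)" for n t
    using pos_powr_add [of t "a - 1" "of_nat n"] pos_powr_of_nat [of t n]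
    by (cases "t > 0") (simp_all add: k_def algebra_simps, simp add: pos_powr_def)
  have int_k: "integrable lborel k"
    unfolding k_def using integrable_Beta_complex [OF a b] .
  have int: "integrable lborel (T n)" for n
    unfolding T_def moment using integrable_Beta_complex [of "a + of_nat n" b] a b by simp
  have val: "integral\<^sup>L lborel (T n) =
      Beta a b * (pochhammer a n / pochhammer (a + b) n * z ^ n / fact n)" for n
    unfolding T_def moment using a b
    by (simp add: integral_Beta_complex Beta_add_of_nat_left)
  have bound: "cmod (T n t) \<le> cmod z ^ n / fact n * cmod (k t)" for n t
  proof (cases "0 < t \<and> t < 1")
    case True
    then have "cmod (k t) * t ^ n \<le> cmod (k t)"
      by (intro mult_left_le power_le_one) auto
    with True show ?thesis
      by (auto simp: T_def norm_mult norm_divide norm_power intro!: divide_right_mono mult_left_mono)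
  qed (auto simp: T_def k_def pos_powr_def)
  have summ: "summable (\<lambda>n. cmod z ^ n / fact n * c)" for c
    using summable_exp [of "cmod z"] by (intro summable_mult2) (simp add: field_simps)
  have norms: "summable (\<lambda>n. cmod (T n t))" for t
    by (rule summable_comparison_test' [OF summ]) (use bound in auto)
  have int_norms: "summable (\<lambda>n. LINT t|lborel. cmod (T n t))"
  proof (rule summable_comparison_test' [OF summ])
    fix n
    have "(LINT t|lborel. cmod (T n t)) \<le>
        (LINT t|lborel. cmod z ^ n / fact n * cmod (k t))"
      using int int_k bound by (intro integral_mono) auto
    then show "norm (LINT t|lborel. cmod (T n t)) \<le>
        cmod z ^ n / fact n * (LINT t|lborel. cmod (k t))"
      by simp
  qed
  have "(\<lambda>n. T n t) sums (k t * exp (z * of_real t))" for t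
    using sums_mult [OF exp_converges [of "z * of_real t"], of "k t"]
    by (simp add: T_def scaleR_conv_of_real power_mult_distrib divide_inverse mult_ac)
  then have "(LINT t|lborel. k t * exp (z * of_real t)) = (LINT t|lborel. (\<Sum>n. T n t))"
    by (simp add: sums_iff)
  also have "\<dots> = Beta a b * hypergeo_1F1 a (a + b) z"
  proof -
    have "(\<lambda>n. integral\<^sup>L lborel (T n)) sums (LINT t|lborel. (\<Sum>n. T n t))"
      using int norms int_norms by (intro sums_integral) auto
    then have "(\<lambda>n. Beta a b * (pochhammer a n / pochhammer (a + b) n * z ^ n / fact n)) sums
        (LINT t|lborel. (\<Sum>n. T n t))"
      unfolding val .
    moreover have nz: "Beta a b \<noteq> 0"
      using a b by (simp add: Beta_def Gamma_eq_zero_iff Re_pos_notin_nonpos_Ints)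
    \<comment> \<open>A nonzero factor lets the convergence of the integrated series pass to the
        series that defines the hypergeometric function.\<close>
    ultimately have "(\<lambda>n. pochhammer a n / pochhammer (a + b) n * z ^ n / fact n) sums
        ((LINT t|lborel. (\<Sum>n. T n t)) / Beta a b)"
      by (rule sums_mult_D)
    then show ?thesis
      unfolding hypergeo_1F1_series using nz by (simp only: sums_iff) simp
  qed
  finally show ?thesis
    by (simp add: k_def)
qed

theorem theorem1:
  fixes \<sigma> \<rho> lam :: real
  assumes "\<sigma> > -1" and "lam \<noteq> 0"
  shows "c_bullet_plus \<sigma> lam \<rho> =
    complex_of_real (cmod (Gamma (of_real (\<sigma> + 1) + \<i> * of_real \<rho>)))
    / (of_real pi * complex_of_real lam powr of_real (\<sigma> + 1))
    * of_real (exp (pi * \<rho> / 2)) * coulomb_F \<sigma> \<rho> lam"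
proof -
  define a where "a = complex_of_real (\<sigma> + 1) - \<i> * of_real \<rho>"
  define b where "b = complex_of_real (\<sigma> + 1) + \<i> * of_real \<rho>"
  define z where "z = 2 * \<i> * complex_of_real lam"
  have ab: "Re a > 0" "Re b > 0" "a + b = of_real (2 * \<sigma> + 2)"
    using assms by (simp_all add: a_def b_def)
  define J where "J \<alpha> = pos_powr ((1 - \<alpha>\<^sup>2) / 2) (of_real \<sigma> + \<i> * of_real \<rho>)
        * complex_of_real ((1 + \<alpha>\<^sup>2) / 2 + \<alpha>) powr (- \<i> * of_real \<rho>)
        * exp (\<i> * of_real lam * of_real \<alpha>)" for \<alpha>
  \<comment> \<open>Collecting the exponents of 2 gives \<open>\<sigma> + \<i> \<rho> - \<i> \<rho> = \<sigma>\<close>, those of \<open>t\<close> give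
      \<open>\<sigma> + \<i> \<rho> - 2 \<i> \<rho> = a - 1\<close>, and only the first power contributes to \<open>1 - t\<close>.\<close>
  have J: "J (- 1 + 2 * t) = of_real (2 powr \<sigma>) * exp (- \<i> * of_real lam) *
      (pos_powr t (a - 1) * pos_powr (1 - t) (b - 1) * exp (z * of_real t))" for t
  proof (cases "0 < t \<and> t < 1")
    case True
    have "(1 - (- 1 + 2 * t)\<^sup>2) / 2 = 2 * t * (1 - t)"
      by (simp add: power2_eq_square field_simps)
    then have 1: "pos_powr ((1 - (- 1 + 2 * t)\<^sup>2) / 2) (of_real \<sigma> + \<i> * of_real \<rho>) =
        exp ((of_real \<sigma> + \<i> * of_real \<rho>) * (of_real (ln 2) + of_real (ln t) + of_real (ln (1 - t))))"
      using True by (simp add: pos_powr_eq_exp ln_mult add.assoc)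
    have "(1 + (- 1 + 2 * t)\<^sup>2) / 2 + (- 1 + 2 * t) = 2 * t\<^sup>2"
      by (simp add: power2_eq_square field_simps)
    then have 2: "complex_of_real ((1 + (- 1 + 2 * t)\<^sup>2) / 2 + (- 1 + 2 * t)) powr (- \<i> * of_real \<rho>) =
        exp (- \<i> * of_real \<rho> * (of_real (ln 2) + 2 * of_real (ln t)))"
      using True by (simp only:) (simp add: powr_def Ln_of_real ln_mult ln_realpow
          del: of_real_mult of_real_power, simp)
    have 3: "of_real (2 powr \<sigma>) = exp (of_real \<sigma> * of_real (ln 2) :: complex)"
      by (simp add: powr_def flip: exp_of_real)
    show ?thesis
      using True unfolding J_def 1 2 3
      by (simp add: pos_powr_eq_exp exp_add [symmetric] a_def b_def z_def) (simp add: algebra_simps)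
  next
    case False
    then have "t * (1 - t) \<le> 0"
      by (auto simp: mult_le_0_iff)
    then have "(1 - (- 1 + 2 * t)\<^sup>2) / 2 \<le> 0"
      by (simp add: power2_eq_square field_simps)
    with False show ?thesis
      by (auto simp: J_def pos_powr_def)
  qed
  have Beta: "Beta a b = of_real ((cmod (Gamma b))\<^sup>2 / Gamma (2 * \<sigma> + 2))"
  proof -
    have "Gamma a = cnj (Gamma b)"
      by (simp add: cnj_Gamma a_def b_def)
    then show ?thesis
      unfolding Beta_def ab(3) Gamma_complex_of_real
      by (simp add: complex_norm_square [symmetric] mult.commute)
  qed
  have "c_bullet_plus \<sigma> lam \<rho> = 1 / (2 * of_real pi) * integral\<^sup>L lborel J"
    unfolding c_bullet_plus_integral J_def ..
  also have "integral\<^sup>L lborel J = 2 * (LINT t|lborel. J (- 1 + 2 * t))"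
    using lborel_integral_real_affine [of 2 J "- 1"] by (simp add: scaleR_conv_of_real)
  also have "(LINT t|lborel. J (- 1 + 2 * t)) = of_real (2 powr \<sigma>) * exp (- \<i> * of_real lam) *
      (Beta a b * hypergeo_1F1 a (a + b) z)"
    unfolding J Euler_integral_1F1 [OF ab(1,2), symmetric] by simp
  finally have c: "c_bullet_plus \<sigma> lam \<rho> = of_real (2 powr \<sigma>) / of_real pi * exp (- \<i> * of_real lam) *
      (Beta a b * hypergeo_1F1 a (a + b) z)"
    by simp
  have "complex_of_real (exp (pi * \<rho> / 2)) * of_real (exp (- pi * \<rho> / 2)) = 1"
    by (simp flip: of_real_mult exp_add)
  moreover have "complex_of_real lam powr of_real (\<sigma> + 1) \<noteq> 0"
    using assms by simp
  ultimately show ?thesis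
    unfolding c Beta ab(3) coulomb_F_def coulomb_C_def a_def [symmetric] b_def [symmetric] z_def [symmetric]
    by (simp add: power2_eq_square divide_simps mult_ac)
qed

end
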